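(* For any symmetric function $F$ (with rational coefficients), there exists a unique supersymmetric function $\widehat{F}\in\Gamma$ such that $$\widehat{F}(\lambda_1,\lambda_2,\dots,\lambda_{\ell(\lambda)})=F\big(\widehat{c}_\square:\square\in S(\lambda)\big)$$ for every strict partition $\lambda$. Here $F(\widehat{c}_\square:\square\in S(\lambda))$ denotes the specialization of $F(x_1,x_2,\dots)$ in which the first $|\lambda|$ variables are replaced by the numbers $\widehat c_\square$, $\square\in S(\lambda)$ (in any order), and all other variables by $0$.
   Context: A strict partition is a finite strictly decreasing sequence $\lambda=(\lambda_1,\dots,\lambda_l)$ of positive integers (the empty partition included); $\ell(\lambda)=l$, $|\lambda|=\sum_i\lambda_i$. Its shifted Young diagram is $S(\lambda)=\{(i,j)\in\mathbb{Z}^2:1\le i\le\ell(\lambda),\ i\le j\le\lambda_i+i-1\}$. For a box $\square=(i,j)\in S(\lambda)$, its content is $c_\square=j-i$, and $\widehat c_\square=\tfrac12 c_\square(c_\square+1)$. $\Gamma$ is the $\mathbb{Q}$-subalgebra of the algebra of symmetric functions generated by the odd power sums $p_1,p_3,p_5,\dots$, where $p_r=x_1^r+x_2^r+\cdots$; its elements are called supersymmetric functions. For $f\in\Gamma$, $f(\lambda_1,\dots,\lambda_{\ell(\lambda)})$ means $f$ evaluated at $x_i=\lambda_i$ ($i\le\ell(\lambda)$), $x_i=0$ ($i>\ell(\lambda)$). *)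

theory Defs
  imports Complex_Main "HOL-Library.Multiset" "HOL-Library.Groups_Big_Fun"
begin

section \<open>The algebra of symmetric functions over the rationals\<close>

text \<open>
  The variables are \<open>x\<^sub>0, x\<^sub>1, \<dots>\<close> (indexed from 0, not from 1). The multiset \<open>{#i, j, \<dots>#}\<close> encodes
  the monomial \<open>x\<^sub>i x\<^sub>j \<dots>\<close>, so its \<^const>\<open>size\<close> is the degree. A symmetric function is a
  formal series, given by its coefficients, which has bounded degree and is invariant under all
  permutations of the variables.
\<close>

typedef symfun =
  "{f :: nat multiset \<Rightarrow> rat.
      (\<forall>\<pi> m. bij \<pi> \<longrightarrow> f (image_mset \<pi> m) = f m) \<and> (\<exists>d. \<forall>m. f m \<noteq> 0 \<longrightarrow> size m \<le> d)}"
  morphisms sf_coeff Abs_symfun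
  by (rule exI[of _ "\<lambda>_. 0"]) simp

setup_lifting type_definition_symfun

definition splits :: "nat multiset \<Rightarrow> (nat multiset \<times> nat multiset) set" where
  "splits m = {(a, b). a + b = m}"

lemma finite_splits: "finite (splits m)"
proof (induction m)
  case empty
  have "splits {#} \<subseteq> {({#}, {#})}" by (auto simp: splits_def)
  then show ?case by (rule finite_subset) simp
next
  case (add x m)
  have "splits (add_mset x m) \<subseteq>
    (\<lambda>(a, b). (add_mset x a, b)) ` splits m \<union> (\<lambda>(a, b). (a, add_mset x b)) ` splits m"
  proof (rule subsetI, clarify)
    fix a b assume ab: "(a, b) \<in> splits (add_mset x m)"
      and nb: "(a, b) \<notin> (\<lambda>(a, b). (a, add_mset x b)) ` splits m"
    have e: "a + b = add_mset x m" using ab by (simp add: splits_def)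
    then have "x \<in># a \<or> x \<in># b" by (metis union_iff union_single_eq_member add_mset_add_single union_commute)
    then show "(a, b) \<in> (\<lambda>(a, b). (add_mset x a, b)) ` splits m"
    proof
      assume "x \<in># a"
      then obtain a' where "a = add_mset x a'" by (metis multi_member_split)
      with e show ?thesis by (auto simp: splits_def image_iff)
    next
      assume "x \<in># b"
      then obtain b' where "b = add_mset x b'" by (metis multi_member_split)
      with e nb show ?thesis by (auto simp: splits_def image_iff)
    qed
  qed
  then show ?case by (rule finite_subset) (simp add: add.IH)
qed

lemma sum_splits_commute: "(\<Sum>(a, b)\<in>splits m. h a b) = (\<Sum>(a, b)\<in>splits m. h b a)"
  by (rule sum.reindex_bij_witness[where i = prod.swap and j = prod.swap])
    (auto simp: splits_def add.commute)

lemma sum_splits_assoc: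
  "(\<Sum>(a, b)\<in>splits m. \<Sum>(c, d)\<in>splits a. h c d b) =
   (\<Sum>(a, b)\<in>splits m. \<Sum>(c, d)\<in>splits b. h a c d)"
proof -
  have "(\<Sum>(a, b)\<in>splits m. \<Sum>(c, d)\<in>splits a. h c d b) =
    (\<Sum>p\<in>(SIGMA p:splits m. splits (fst p)). h (fst (snd p)) (snd (snd p)) (snd (fst p)))"
    by (simp add: case_prod_unfold sum.Sigma finite_splits)
  also have "\<dots> = (\<Sum>p\<in>(SIGMA p:splits m. splits (snd p)). h (fst (fst p)) (fst (snd p)) (snd (snd p)))"
    by (rule sum.reindex_bij_witness[where
          i = "\<lambda>((a, b), (c, d)). ((a + c, d), (a, c))" and
          j = "\<lambda>((a, b), (c, d)). ((c, d + b), (d, b))"])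
      (auto simp: splits_def add.assoc)
  also have "\<dots> = (\<Sum>(a, b)\<in>splits m. \<Sum>(c, d)\<in>splits b. h a c d)"
    by (simp add: case_prod_unfold sum.Sigma finite_splits)
  finally show ?thesis .
qed

lemma sum_splits_image:
  assumes "bij \<pi>"
  shows "(\<Sum>(a, b)\<in>splits (image_mset \<pi> m). h a b) =
    (\<Sum>(a, b)\<in>splits m. h (image_mset \<pi> a) (image_mset \<pi> b))"
proof -
  have 1: "image_mset (inv \<pi>) (image_mset \<pi> a) = a" for a
    using assms by (simp add: multiset.map_comp bij_is_inj)
  have 2: "image_mset \<pi> (image_mset (inv \<pi>) a) = a" for a
    using assms by (simp add: multiset.map_comp surj_iff[THEN iffD1, OF bij_is_surj])
  show ?thesis
    by (rule sum.reindex_bij_witness[where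
          i = "\<lambda>(a, b). (image_mset \<pi> a, image_mset \<pi> b)" and
          j = "\<lambda>(a, b). (image_mset (inv \<pi>) a, image_mset (inv \<pi>) b)"])
      (auto simp: splits_def 1 2 simp flip: image_mset_union)
qed

instantiation symfun :: comm_ring_1
begin

lift_definition zero_symfun :: symfun is "\<lambda>_. 0" by simp

lift_definition one_symfun :: symfun is "\<lambda>m. if m = {#} then 1 else 0"
  by (auto intro: exI[of _ 0])

lift_definition plus_symfun :: "symfun \<Rightarrow> symfun \<Rightarrow> symfun" is "\<lambda>f g m. f m + g m"
proof safe
  fix f g :: "nat multiset \<Rightarrow> rat" and d e
  assume "\<forall>m. f m \<noteq> 0 \<longrightarrow> size m \<le> d" "\<forall>m. g m \<noteq> 0 \<longrightarrow> size m \<le> e"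
  then show "\<exists>d. \<forall>m. f m + g m \<noteq> 0 \<longrightarrow> size m \<le> d"
    by (intro exI[of _ "max d e"]) (metis add_0 max.coboundedI1 max.coboundedI2)
qed simp

lift_definition uminus_symfun :: "symfun \<Rightarrow> symfun" is "\<lambda>f m. - f m" by simp

definition minus_symfun :: "symfun \<Rightarrow> symfun \<Rightarrow> symfun" where "minus_symfun f g = f + - g"

lift_definition times_symfun :: "symfun \<Rightarrow> symfun \<Rightarrow> symfun"
  is "\<lambda>f g m. \<Sum>(a, b)\<in>splits m. f a * g b"
proof safe
  fix f g :: "nat multiset \<Rightarrow> rat" and d e
  assume fg: "\<forall>m. f m \<noteq> 0 \<longrightarrow> size m \<le> d" "\<forall>m. g m \<noteq> 0 \<longrightarrow> size m \<le> e"
  show "\<exists>d. \<forall>m. (\<Sum>(a, b)\<in>splits m. f a * g b) \<noteq> 0 \<longrightarrow> size m \<le> d"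
  proof (intro exI[of _ "d + e"] allI impI)
    fix m assume "(\<Sum>(a, b)\<in>splits m. f a * g b) \<noteq> 0"
    then obtain p where "p \<in> splits m" "(case p of (a, b) \<Rightarrow> f a * g b) \<noteq> 0"
      by (rule sum.not_neutral_contains_not_neutral)
    with fg show "size m \<le> d + e"
      by (auto simp: splits_def intro!: add_mono)
  qed
next
  fix f g :: "nat multiset \<Rightarrow> rat" and \<pi> :: "nat \<Rightarrow> nat" and m
  assume "\<forall>\<pi> m. bij \<pi> \<longrightarrow> f (image_mset \<pi> m) = f m"
    "\<forall>\<pi> m. bij \<pi> \<longrightarrow> g (image_mset \<pi> m) = g m" "bij \<pi>"
  then show "(\<Sum>(a, b)\<in>splits (image_mset \<pi> m). f a * g b) = (\<Sum>(a, b)\<in>splits m. f a * g b)"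
    by (simp add: sum_splits_image)
qed

instance
proof
  fix f g h :: symfun
  show "f * g * h = f * (g * h)"
  proof (transfer, rule ext)
    fix f g h :: "nat multiset \<Rightarrow> rat" and m
    show "(\<Sum>(a, b)\<in>splits m. (\<Sum>(a, b)\<in>splits a. f a * g b) * h b) =
      (\<Sum>(a, b)\<in>splits m. f a * (\<Sum>(a, b)\<in>splits b. g a * h b))"
      using sum_splits_assoc[of "\<lambda>a b c. f a * g b * h c" m]
      by (simp add: sum_distrib_left sum_distrib_right case_prod_unfold mult.assoc)
  qed
  show "f * g = g * f"
  proof (transfer, rule ext)
    fix f g :: "nat multiset \<Rightarrow> rat" and m
    show "(\<Sum>(a, b)\<in>splits m. f a * g b) = (\<Sum>(a, b)\<in>splits m. g a * f b)"
      using sum_splits_commute[of "\<lambda>a b. f a * g b" m] by (simp add: mult.commute)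
  qed
  show "1 * f = f"
  proof (transfer, rule ext)
    fix f :: "nat multiset \<Rightarrow> rat" and m
    have "(\<Sum>(a, b)\<in>splits m. (if a = {#} then 1 else 0) * f b) =
      (\<Sum>(a, b)\<in>{({#} :: nat multiset, m)}. (if a = {#} then 1 else 0) * f b)"
      by (rule sum.mono_neutral_right) (auto simp: finite_splits, auto simp: splits_def split: if_splits)
    then show "(\<Sum>(a, b)\<in>splits m. (if a = {#} then 1 else 0) * f b) = f m" by simp
  qed
  show "(f + g) * h = f * h + g * h"
    by transfer (auto simp: case_prod_unfold distrib_right sum.distrib)
  show "(0 :: symfun) \<noteq> 1"
    by transfer (metis zero_neq_one)
  show "f + g + h = f + (g + h)" by transfer (simp add: add.assoc)
  show "f + g = g + f" by transfer (simp add: add.commute)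
  show "0 + f = f" by transfer simp
  show "- f + f = 0" by transfer simp
  show "f - g = f + - g" by (rule minus_symfun_def)
qed

end

lift_definition sf_scale :: "rat \<Rightarrow> symfun \<Rightarrow> symfun" is "\<lambda>c f m. c * f m"
  by auto

lift_definition power_sum :: "nat \<Rightarrow> symfun"
  is "\<lambda>r m. if \<exists>i. m = replicate_mset r i then 1 else 0"
proof (rule conjI)
  fix r
  show "\<forall>(\<pi> :: nat \<Rightarrow> nat) m. bij \<pi> \<longrightarrow>
    (if \<exists>i. image_mset \<pi> m = replicate_mset r i then 1 else (0 :: rat)) =
    (if \<exists>i. m = replicate_mset r i then 1 else 0)"
  proof (intro allI impI)
    fix \<pi> :: "nat \<Rightarrow> nat" and m :: "nat multiset"
    assume "bij \<pi>"
    then have "image_mset (inv \<pi>) (image_mset \<pi> m) = m"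
      by (simp add: multiset.map_comp bij_is_inj)
    then have "(\<exists>i. image_mset \<pi> m = replicate_mset r i) \<longleftrightarrow> (\<exists>i. m = replicate_mset r i)"
      by (metis image_replicate_mset)
    then show "(if \<exists>i. image_mset \<pi> m = replicate_mset r i then 1 else (0 :: rat)) =
      (if \<exists>i. m = replicate_mset r i then 1 else 0)" by simp
  qed
  show "\<exists>d. \<forall>m. (if \<exists>i. m = replicate_mset r i then 1 else (0 :: rat)) \<noteq> 0 \<longrightarrow> size m \<le> d"
    by (intro exI[of _ r]) auto
qed

section \<open>Supersymmetric functions\<close>

definition subalgebra :: "symfun set \<Rightarrow> bool" where
  "subalgebra A \<longleftrightarrow> 1 \<in> A \<and> (\<forall>f\<in>A. \<forall>g\<in>A. f + g \<in> A \<and> f * g \<in> A) \<and> (\<forall>c. \<forall>f\<in>A. sf_scale c f \<in> A)"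

definition supersymmetric :: "symfun set" where
  "supersymmetric = subalgebra hull {power_sum r | r. odd r}"

lemma subalgebra_supersymmetric: "subalgebra supersymmetric"
  unfolding supersymmetric_def by (rule hull_in) (auto simp: subalgebra_def)

section \<open>Evaluation\<close>

text \<open>
  \<open>sf_eval F [a\<^sub>1, \<dots>, a\<^sub>n]\<close> substitutes \<open>a\<^sub>1, \<dots>, a\<^sub>n\<close> for the first \<open>n\<close> variables and 0 for the others.
  Only finitely many monomials contribute (lemma \<open>finite_sf_eval\<close>), so \<^const>\<open>Sum_any\<close> is here the
  actual sum, not its default value 0.
\<close>

definition zero_extend :: "rat list \<Rightarrow> nat \<Rightarrow> rat" where
  "zero_extend xs i = (if i < length xs then xs ! i else 0)"

definition sf_eval :: "symfun \<Rightarrow> rat list \<Rightarrow> rat" where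
  "sf_eval F xs = Sum_any (\<lambda>m. sf_coeff F m * (\<Prod>i\<in>#m. zero_extend xs i))"

lemma finite_sf_eval: "finite {m. sf_coeff F m * (\<Prod>i\<in>#m. zero_extend xs i) \<noteq> 0}"
proof -
  obtain d where d: "\<And>m. sf_coeff F m \<noteq> 0 \<Longrightarrow> size m \<le> d"
    using sf_coeff[of F] by auto
  have "{m. sf_coeff F m * (\<Prod>i\<in>#m. zero_extend xs i) \<noteq> 0}
    \<subseteq> mset ` {ys. set ys \<subseteq> {..<length xs} \<and> length ys \<le> d}"
  proof clarify
    fix m assume m: "sf_coeff F m * (\<Prod>i\<in>#m. zero_extend xs i) \<noteq> 0"
    obtain ys where ys: "m = mset ys" by (metis ex_mset)
    have "i < length xs" if "i \<in># m" for i
    proof (rule ccontr)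
      assume "\<not> i < length xs"
      then have "zero_extend xs i = 0" by (simp add: zero_extend_def)
      with that have "(\<Prod>i\<in>#m. zero_extend xs i) = 0" by (force simp: prod_mset_zero_iff)
      with m show False by simp
    qed
    moreover have "size m \<le> d" using m by (intro d) auto
    ultimately show "m \<in> mset ` {ys. set ys \<subseteq> {..<length xs} \<and> length ys \<le> d}"
      using ys by auto
  qed
  then show ?thesis by (rule finite_subset) (simp add: finite_lists_length_le)
qed

section \<open>Strict partitions and shifted Young diagrams\<close>

definition strict_partition :: "nat list \<Rightarrow> bool" where
  "strict_partition lam \<longleftrightarrow> sorted_wrt (>) lam \<and> (\<forall>k\<in>set lam. k > 0)"

text \<open>
  Boxes are counted from 1 and list positions from 0, so the \<open>i\<close>-th part of \<open>lam\<close> is \<open>lam ! (i - 1)\<close>.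
\<close>

definition shifted_diagram :: "nat list \<Rightarrow> (int \<times> int) set" where
  "shifted_diagram lam =
    {(i, j). 1 \<le> i \<and> i \<le> int (length lam) \<and> i \<le> j \<and> j \<le> int (lam ! nat (i - 1)) + i - 1}"

lemma finite_shifted_diagram: "finite (shifted_diagram lam)"
proof (rule finite_subset)
  let ?n = "int (length lam)"
  show "shifted_diagram lam \<subseteq> (SIGMA i:{1..?n}. {i..int (lam ! nat (i - 1)) + i - 1})"
    by (auto simp: shifted_diagram_def)
  show "finite (SIGMA i:{1..?n}. {i..int (lam ! nat (i - 1)) + i - 1})" by simp
qed

definition content :: "int \<times> int \<Rightarrow> int" where
  "content b = snd b - fst b"

definition chat :: "int \<times> int \<Rightarrow> rat" where
  "chat b = 1 / 2 * of_int (content b) * (of_int (content b) + 1)"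

end

theory Submission
  imports Defs "HOL-Computational_Algebra.Polynomial" "HOL-Combinatorics.Multiset_Permutations"
begin

text \<open>
  Uniqueness does not involve oddness: already the values at strict partitions determine a
  symmetric function, since a polynomial vanishing at all strictly decreasing tuples of positive
  integers is zero. For existence, every symmetric function is a polynomial in the power sums, so
  one may take \<open>F = p\<^sub>r\<close>. The \<open>i\<close>-th row of the diagram has contents \<open>0, \<dots>, \<lambda>\<^sub>i - 1\<close>, and
  \<open>\<Sum>c<n. (c (c + 1) / 2) ^ r\<close> is an odd polynomial in \<open>n\<close>, so summing over the rows gives a
  linear combination of odd power sums of the parts.
\<close>

section \<open>Evaluation is an algebra homomorphism\<close>

text \<open>A finite index set large enough for every evaluation at \<open>n\<close> values of a
  symmetric function of degree at most \<open>d\<close>; it turns \<open>Sum_any\<close> into an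
  ordinary sum that can be rearranged.\<close>

definition monomials :: "nat \<Rightarrow> nat \<Rightarrow> nat multiset set" where
  "monomials n d = {m. set_mset m \<subseteq> {..<n} \<and> size m \<le> d}"

lemma finite_monomials: "finite (monomials n d)"
proof (rule finite_subset)
  show "monomials n d \<subseteq> mset ` {ys. set ys \<subseteq> {..<n} \<and> length ys \<le> d}"
  proof
    fix m assume "m \<in> monomials n d"
    moreover obtain ys where "m = mset ys" by (metis ex_mset)
    ultimately show "m \<in> mset ` {ys. set ys \<subseteq> {..<n} \<and> length ys \<le> d}"
      by (auto simp: monomials_def)
  qed
qed (simp add: finite_lists_length_le)

lemma sf_degree_bounded: "\<exists>d. \<forall>m. sf_coeff F m \<noteq> 0 \<longrightarrow> size m \<le> d"
  using sf_coeff[of F] by auto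

lemma prod_mset_zero_extend_eq_0:
  assumes "\<not> set_mset m \<subseteq> {..<length xs}"
  shows "(\<Prod>i\<in>#m. zero_extend xs i) = 0"
proof -
  obtain i where "i \<in># m" "\<not> i < length xs" using assms by auto
  then have "i \<in># m" "zero_extend xs i = 0" by (auto simp: zero_extend_def)
  then show ?thesis by (force simp: prod_mset_zero_iff)
qed

lemma sf_eval_eq_sum:
  assumes "\<And>m. sf_coeff F m \<noteq> 0 \<Longrightarrow> size m \<le> d"
  shows "sf_eval F xs =
    (\<Sum>m\<in>monomials (length xs) d. sf_coeff F m * (\<Prod>i\<in>#m. zero_extend xs i))"
  unfolding sf_eval_def
proof (rule Sum_any.expand_superset[OF finite_monomials], clarify)
  fix m assume m: "sf_coeff F m * (\<Prod>i\<in>#m. zero_extend xs i) \<noteq> 0"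
  then show "m \<in> monomials (length xs) d"
    using assms prod_mset_zero_extend_eq_0[of m xs] by (auto simp: monomials_def)
qed

lemma sf_eval_add: "sf_eval (F + G) xs = sf_eval F xs + sf_eval G xs"
  unfolding sf_eval_def
  unfolding plus_symfun.rep_eq distrib_right
  by (rule Sum_any.distrib; rule finite_sf_eval)

lemma sf_eval_scale: "sf_eval (sf_scale c F) xs = c * sf_eval F xs"
  unfolding sf_eval_def
  unfolding sf_scale.rep_eq mult.assoc
  by (rule Sum_any_right_distrib[symmetric]) (rule finite_sf_eval)

lemma sf_eval_one: "sf_eval 1 xs = 1"
proof -
  have "sf_eval 1 xs =
    (\<Sum>m\<in>monomials (length xs) 0. sf_coeff 1 m * (\<Prod>i\<in>#m. zero_extend xs i))"
    by (rule sf_eval_eq_sum) (auto simp: one_symfun.rep_eq split: if_splits)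
  also have "monomials (length xs) 0 = {{#}}" by (auto simp: monomials_def)
  finally show ?thesis by (simp add: one_symfun.rep_eq)
qed

text \<open>The left side becomes a sum over pairs \<open>(a, b)\<close> with \<open>a + b\<close>
  in \<open>monomials n (d + e)\<close>. These pairs include the rectangle
  \<open>monomials n d \<times> monomials n e\<close>, and outside it the degree bounds make one of
  the two coefficients vanish.\<close>

lemma sf_eval_mult: "sf_eval (F * G) xs = sf_eval F xs * sf_eval G xs"
proof -
  obtain d where d: "\<And>m. sf_coeff F m \<noteq> 0 \<Longrightarrow> size m \<le> d" using sf_degree_bounded by blast
  obtain e where e: "\<And>m. sf_coeff G m \<noteq> 0 \<Longrightarrow> size m \<le> e" using sf_degree_bounded by blast
  define n where "n = length xs"
  define z where "z m = (\<Prod>i\<in>#m. zero_extend xs i)" for m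
  define h where "h = (\<lambda>(a, b). (sf_coeff F a * z a) * (sf_coeff G b * z b))"
  have de: "size m \<le> d + e" if "sf_coeff (F * G) m \<noteq> 0" for m
  proof -
    have "(\<Sum>(a, b)\<in>splits m. sf_coeff F a * sf_coeff G b) \<noteq> 0"
      using that by (simp add: times_symfun.rep_eq)
    then obtain p where "p \<in> splits m" "(case p of (a, b) \<Rightarrow> sf_coeff F a * sf_coeff G b) \<noteq> 0"
      by (rule sum.not_neutral_contains_not_neutral)
    then show ?thesis using d e by (auto simp: splits_def intro!: add_mono)
  qed
  have "sf_eval (F * G) xs = (\<Sum>m\<in>monomials n (d + e). sf_coeff (F * G) m * z m)"
    unfolding n_def z_def by (rule sf_eval_eq_sum[OF de])
  also have "\<dots> = (\<Sum>m\<in>monomials n (d + e). \<Sum>p\<in>splits m. h p)"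
    by (intro sum.cong refl)
      (auto simp: times_symfun.rep_eq sum_distrib_right h_def splits_def z_def intro!: sum.cong)
  also have "\<dots> = (\<Sum>q\<in>(SIGMA m:monomials n (d + e). splits m). h (snd q))"
    by (simp add: sum.Sigma finite_monomials finite_splits case_prod_unfold)
  also have "\<dots> = (\<Sum>p\<in>{(a, b). a + b \<in> monomials n (d + e)}. h p)"
    by (rule sum.reindex_bij_witness[where i = "\<lambda>(a, b). (a + b, (a, b))" and j = snd])
      (auto simp: splits_def)
  also have "\<dots> = (\<Sum>p\<in>monomials n d \<times> monomials n e. h p)"
  proof (rule sum.mono_neutral_right)
    have "{(a, b). a + b \<in> monomials n (d + e)} \<subseteq> monomials n (d + e) \<times> monomials n (d + e)"
      by (auto simp: monomials_def)
    then show "finite {(a, b). a + b \<in> monomials n (d + e)}"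
      by (rule finite_subset) (simp add: finite_monomials)
    show "monomials n d \<times> monomials n e \<subseteq> {(a, b). a + b \<in> monomials n (d + e)}"
      by (auto simp: monomials_def)
    show "\<forall>p\<in>{(a, b). a + b \<in> monomials n (d + e)} - monomials n d \<times> monomials n e. h p = 0"
      using d e by (fastforce simp: monomials_def h_def)
  qed
  also have "\<dots> = (\<Sum>a\<in>monomials n d. sf_coeff F a * z a) * (\<Sum>b\<in>monomials n e. sf_coeff G b * z b)"
    by (simp add: sum_product sum.cartesian_product h_def)
  also have "\<dots> = sf_eval F xs * sf_eval G xs"
    unfolding n_def z_def using sf_eval_eq_sum[of F d xs, OF d] sf_eval_eq_sum[of G e xs, OF e] by simp
  finally show ?thesis .
qed

text \<open>For \<open>r > 0\<close> the monomials \<open>replicate_mset r i\<close> are distinct,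
  one per variable. For \<open>r = 0\<close> they all collapse to the empty monomial, and the two
  sides are \<open>1\<close> and \<open>length xs\<close>.\<close>

lemma sf_eval_power_sum:
  assumes "r > 0"
  shows "sf_eval (power_sum r) xs = (\<Sum>x\<leftarrow>xs. x ^ r)"
proof -
  let ?n = "length xs"
  have "sf_eval (power_sum r) xs =
    (\<Sum>m\<in>monomials ?n r. sf_coeff (power_sum r) m * (\<Prod>i\<in>#m. zero_extend xs i))"
    by (rule sf_eval_eq_sum) (auto simp: power_sum.rep_eq split: if_splits)
  also have "\<dots> = (\<Sum>m\<in>replicate_mset r ` {..<?n}. (\<Prod>i\<in>#m. zero_extend xs i))"
    using assms
    by (intro sum.mono_neutral_cong_right finite_monomials)
      (auto simp: monomials_def power_sum.rep_eq split: if_splits)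
  also have "\<dots> = (\<Sum>i<?n. xs ! i ^ r)"
  proof (subst sum.reindex)
    show "inj_on (replicate_mset r) {..<?n}"
      using assms by (auto simp: inj_on_def) (metis in_replicate_mset)
  qed (simp add: zero_extend_def)
  also have "\<dots> = (\<Sum>x\<leftarrow>xs. x ^ r)"
    by (simp add: sum_list_sum_nth atLeast0LessThan)
  finally show ?thesis .
qed

section \<open>Strict partitions separate symmetric functions\<close>

text \<open>Comparison of base \<open>B\<close> expansions digit by digit, the lowest one being the
  residue modulo \<open>B\<close>. The exponents fall with \<open>i\<close> because the parts of the
  partitions built from them must decrease.\<close>

lemma digits_unique:
  fixes a b :: "nat \<Rightarrow> nat"
  assumes "\<And>i. i < n \<Longrightarrow> a i < B" "\<And>i. i < n \<Longrightarrow> b i < B"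
    and "(\<Sum>i<n. a i * B ^ (n - i)) = (\<Sum>i<n. b i * B ^ (n - i))" "i < n"
  shows "a i = b i"
  using assms
proof (induction n arbitrary: i)
  case (Suc n)
  have horner: "(\<Sum>i<Suc n. c i * B ^ (Suc n - i)) = B * (c n + (\<Sum>i<n. c i * B ^ (n - i)))"
    for c :: "nat \<Rightarrow> nat"
    by (simp add: Suc_diff_le distrib_left sum_distrib_left mult.left_commute)
  \<comment> \<open>All exponents \<open>n - i\<close> with \<open>i < n\<close> are positive, so in
    the bracket of \<open>horner\<close> the digit \<open>c n\<close> is the residue modulo
    \<open>B\<close>.\<close>
  have dvd: "B dvd (\<Sum>i<n. c i * B ^ (n - i))" for c :: "nat \<Rightarrow> nat"
    by (intro dvd_sum dvd_mult) simp
  have B: "B > 0" using Suc.prems(1)[of n] by simp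
  obtain s t where s: "(\<Sum>i<n. a i * B ^ (n - i)) = B * s" and t: "(\<Sum>i<n. b i * B ^ (n - i)) = B * t"
    using dvd by (meson dvdE)
  have eq: "a n + B * s = b n + B * t"
    using Suc.prems(3) B unfolding horner s t by simp
  have "a n = (a n + B * s) mod B" using Suc.prems(1)[of n] by simp
  also have "\<dots> = b n" unfolding eq using Suc.prems(2)[of n] by simp
  finally have n: "a n = b n" .
  show ?case
  proof (cases "i = n")
    case False
    with Suc.prems show ?thesis
      using eq n s t by (intro Suc.IH) auto
  qed (simp add: n)
qed simp

text \<open>If the coefficients at \<open>m\<close> differ, restricting \<open>F - G\<close> to a
  curve of strict partitions with parameter \<open>t\<close> gives a polynomial \<open>P\<close> in
  one variable. It vanishes at all integers \<open>t \<ge> 2\<close>, yet its coefficient at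
  \<open>ex m\<close> is the difference of the coefficients at \<open>m\<close>.\<close>

lemma symfun_eqI_strict:
  assumes eq: "\<And>lam. strict_partition lam \<Longrightarrow> sf_eval F (map of_nat lam) = sf_eval G (map of_nat lam)"
  shows "F = G"
proof -
  obtain d where d: "\<And>m. sf_coeff F m \<noteq> 0 \<Longrightarrow> size m \<le> d" using sf_degree_bounded by blast
  obtain e where e: "\<And>m. sf_coeff G m \<noteq> 0 \<Longrightarrow> size m \<le> e" using sf_degree_bounded by blast
  define D where "D = max d e"
  have D: "sf_coeff F m \<noteq> 0 \<Longrightarrow> size m \<le> D" "sf_coeff G m \<noteq> 0 \<Longrightarrow> size m \<le> D" for m
    using d[of m] e[of m] by (auto simp: D_def)
  have "sf_coeff F m = sf_coeff G m" for m
  proof (rule ccontr)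
    assume neq: "sf_coeff F m \<noteq> sf_coeff G m"
    \<comment> \<open>The inserted \<open>0\<close> keeps \<open>Max\<close> meaningful when
      \<open>m\<close> is the empty monomial.\<close>
    define n where "n = Suc (Max (insert 0 (set_mset m)))"
    have "size m \<le> D" using neq D[of m] by (cases "sf_coeff F m = 0") auto
    then have m: "m \<in> monomials n D" by (auto simp: monomials_def n_def less_Suc_eq_le)
    \<comment> \<open>Kronecker substitution: the powers \<open>t ^ (B ^ (n - i))\<close> turn distinct monomials of degree
      at most \<open>D\<close> into distinct powers of \<open>t\<close>.\<close>
    define B where "B = D + 2"
    define ex where "ex q = (\<Sum>i<n. count q i * B ^ (n - i))" for q
    have inj: "q = m" if "q \<in> monomials n D" "ex q = ex m" for q
    proof (rule multiset_eqI)
      fix i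
      have cnt: "count p i < B" if "p \<in> monomials n D" for p i
        using that count_le_size[of p i] by (simp add: monomials_def B_def)
      show "count q i = count m i"
      proof (cases "i < n")
        case True
        show ?thesis
          by (rule digits_unique[where n = n and B = B])
            (use cnt[OF that(1)] cnt[OF m] that(2) True in \<open>auto simp: ex_def\<close>)
      next
        case False
        then have "i \<notin># q" "i \<notin># m" using m that(1) by (auto simp: monomials_def)
        then show ?thesis by (simp add: not_in_iff)
      qed
    qed
    define P where "P = (\<Sum>q\<in>monomials n D. monom (sf_coeff F q - sf_coeff G q) (ex q))"
    have root: "poly P (of_nat t) = 0" if "t \<ge> 2" for t :: nat
    proof -
      define lam where "lam = map (\<lambda>i. t ^ (B ^ (n - i))) [0..<n]"
      \<comment> \<open>The parts decrease because \<open>t \<ge> 2\<close> and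
        \<open>B \<ge> 2\<close>; the choice \<open>B = D + 2\<close> ensures the latter even for
        \<open>D = 0\<close>.\<close>
      have "strict_partition lam"
        unfolding strict_partition_def lam_def
        using that by (auto simp: sorted_wrt_iff_nth_less B_def intro!: power_strict_increasing)
      then have ev: "sf_eval F (map of_nat lam) = sf_eval G (map of_nat lam)" by (rule eq)
      have z: "(\<Prod>i\<in>#q. zero_extend (map of_nat lam) i) = of_nat t ^ ex q"
        if "q \<in> monomials n D" for q
      proof -
        have "(\<Prod>i\<in>#q. zero_extend (map of_nat lam) i) =
          (\<Prod>i\<in>set_mset q. zero_extend (map of_nat lam) i ^ count q i)"
          by (rule image_prod_mset_multiplicity)
        also have "\<dots> = (\<Prod>i<n. (of_nat t ^ (B ^ (n - i))) ^ count q i)"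
          using that
          by (intro prod.mono_neutral_cong_left)
            (auto simp: monomials_def zero_extend_def lam_def not_in_iff)
        also have "\<dots> = of_nat t ^ ex q"
          by (simp add: ex_def power_sum power_mult[symmetric] mult.commute)
        finally show ?thesis .
      qed
      have "poly P (of_nat t) = (\<Sum>q\<in>monomials n D. sf_coeff F q * of_nat t ^ ex q) -
        (\<Sum>q\<in>monomials n D. sf_coeff G q * of_nat t ^ ex q)"
        by (simp add: P_def poly_sum poly_monom left_diff_distrib sum_subtractf)
      also have "\<dots> = sf_eval F (map of_nat lam) - sf_eval G (map of_nat lam)"
        using sf_eval_eq_sum[of F D "map of_nat lam", OF D(1)]
          sf_eval_eq_sum[of G D "map of_nat lam", OF D(2)] z
        by (simp add: lam_def)
      finally show ?thesis using ev by simp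
    qed
    have "infinite ((of_nat :: nat \<Rightarrow> rat) ` {2..})"
      by (subst finite_image_iff) (auto simp: inj_on_def infinite_Ici)
    moreover have "(of_nat :: nat \<Rightarrow> rat) ` {2..} \<subseteq> {x. poly P x = 0}" using root by auto
    ultimately have "P = 0" using poly_roots_finite[of P] finite_subset by blast
    then have "0 = coeff P (ex m)" by simp
    also have "\<dots> = (\<Sum>q\<in>monomials n D. if q = m then sf_coeff F q - sf_coeff G q else 0)"
      unfolding P_def coeff_sum by (intro sum.cong) (auto dest: inj)
    also have "\<dots> = sf_coeff F m - sf_coeff G m" using m by (simp add: finite_monomials)
    finally show False using neq by simp
  qed
  then show ?thesis by (simp add: sf_coeff_inject[symmetric] fun_eq_iff)
qed

section \<open>Power sums generate all symmetric functions\<close>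

definition distinct_tuples :: "nat \<Rightarrow> nat \<Rightarrow> nat list set" where
  "distinct_tuples l n = {is. length is = l \<and> distinct is \<and> set is \<subseteq> {..<n}}"

lemma finite_distinct_tuples: "finite (distinct_tuples l n)"
  by (rule finite_subset[OF _ finite_lists_length_eq[of "{..<n}" l]])
    (auto simp: distinct_tuples_def)

text \<open>The augmented monomial symmetric polynomial: for positive exponents it is the monomial
  symmetric polynomial of \<open>mu\<close> times the factorials of the multiplicities of its parts.
  Summing over injective index tuples keeps such factors out of the product rule with a power
  sum.\<close>

definition aug_monomial :: "nat list \<Rightarrow> rat list \<Rightarrow> rat" where
  "aug_monomial mu xs =
    (\<Sum>is\<in>distinct_tuples (length mu) (length xs). \<Prod>k<length mu. xs ! (is ! k) ^ (mu ! k))"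

text \<open>A factor \<open>x\<^sub>i ^ r\<close> of the power sum either brings in a new index or hits one that is present.\<close>

lemma power_sum_times_aug_monomial:
  "(\<Sum>x\<leftarrow>xs. x ^ r) * aug_monomial mu xs =
    aug_monomial (r # mu) xs + (\<Sum>j<length mu. aug_monomial (mu[j := mu ! j + r]) xs)"
proof -
  let ?l = "length mu" and ?n = "length xs"
  let ?D = "distinct_tuples ?l ?n"
  define T where "T nu is = (\<Prod>k<?l. xs ! (is ! k) ^ (nu ! k))" for nu "is"
  have split: "(\<Sum>i<?n. xs ! i ^ r) * T mu is =
    (\<Sum>i\<in>{..<?n} - set is. xs ! i ^ r * T mu is) + (\<Sum>j<?l. T (mu[j := mu ! j + r]) is)"
    if "is \<in> ?D" for "is"
  proof -
    have l: "length is = ?l" and dist: "distinct is" and sub: "set is \<subseteq> {..<?n}"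
      using that by (auto simp: distinct_tuples_def)
    have "(\<Sum>i<?n. xs ! i ^ r) * T mu is =
      (\<Sum>i\<in>{..<?n} - set is. xs ! i ^ r * T mu is) + (\<Sum>i\<in>set is. xs ! i ^ r * T mu is)"
      using sum.subset_diff[OF sub, of "\<lambda>i. xs ! i ^ r * T mu is"] by (simp add: sum_distrib_right)
    also have "(\<Sum>i\<in>set is. xs ! i ^ r * T mu is) = (\<Sum>j<?l. xs ! (is ! j) ^ r * T mu is)"
      using sum.reindex_bij_betw[OF bij_betw_nth[OF dist refl refl], of "\<lambda>i. xs ! i ^ r * T mu is"]
      by (simp add: l)
    also have "\<dots> = (\<Sum>j<?l. T (mu[j := mu ! j + r]) is)"
    proof (rule sum.cong)
      fix j assume j: "j \<in> {..<?l}"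
      have "T (mu[j := mu ! j + r]) is =
        (\<Prod>k<?l. (if k = j then xs ! (is ! j) ^ r else 1) * xs ! (is ! k) ^ (mu ! k))"
        unfolding T_def using j by (intro prod.cong) (auto simp: power_add)
      also have "\<dots> = xs ! (is ! j) ^ r * T mu is"
        using j by (simp add: prod.distrib T_def)
      finally show "xs ! (is ! j) ^ r * T mu is = T (mu[j := mu ! j + r]) is" by simp
    qed simp
    finally show ?thesis .
  qed
  have "(\<Sum>x\<leftarrow>xs. x ^ r) * aug_monomial mu xs = (\<Sum>is\<in>?D. (\<Sum>i<?n. xs ! i ^ r) * T mu is)"
    by (simp add: aug_monomial_def T_def sum_list_sum_nth atLeast0LessThan sum_distrib_left)
  also have "\<dots> = (\<Sum>is\<in>?D. \<Sum>i\<in>{..<?n} - set is. xs ! i ^ r * T mu is) +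
      (\<Sum>is\<in>?D. \<Sum>j<?l. T (mu[j := mu ! j + r]) is)"
    by (simp add: split sum.distrib)
  also have "(\<Sum>is\<in>?D. \<Sum>j<?l. T (mu[j := mu ! j + r]) is) =
      (\<Sum>j<?l. aug_monomial (mu[j := mu ! j + r]) xs)"
    by (subst sum.swap) (simp add: aug_monomial_def T_def)
  also have "(\<Sum>is\<in>?D. \<Sum>i\<in>{..<?n} - set is. xs ! i ^ r * T mu is) =
      (\<Sum>(is, i)\<in>(SIGMA is:?D. {..<?n} - set is). xs ! i ^ r * T mu is)"
    by (simp add: sum.Sigma finite_distinct_tuples)
  also have "\<dots> = aug_monomial (r # mu) xs"
    unfolding aug_monomial_def
    by (rule sum.reindex_bij_witness[where i = "\<lambda>is. (tl is, hd is)" and j = "\<lambda>(is, i). i # is"])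
      (auto simp: distinct_tuples_def T_def length_Suc_conv prod.lessThan_Suc_shift
        simp del: prod.lessThan_Suc)
  finally show ?thesis .
qed

text \<open>Pairs \<open>(mu, is)\<close> with positive exponents and distinct indices present each
  monomial once for every ordering of its variables. This is the bookkeeping that leads from
  coefficients of monomials to \<open>aug_monomial\<close>.\<close>

definition tuple_mset :: "nat list \<Rightarrow> nat list \<Rightarrow> nat multiset" where
  "tuple_mset mu is = (\<Sum>k<length mu. replicate_mset (mu ! k) (is ! k))"

lemma count_tuple_mset:
  assumes "distinct is" "length is = length mu" "k < length mu"
  shows "count (tuple_mset mu is) (is ! k) = mu ! k"
proof -
  have "count (tuple_mset mu is) (is ! k) = (\<Sum>k'<length mu. if k' = k then mu ! k' else 0)"
    unfolding tuple_mset_def count_sum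
    using assms by (intro sum.cong) (auto simp: nth_eq_iff_index_eq)
  then show ?thesis using assms by simp
qed

lemma set_tuple_mset:
  assumes "length is = length mu" "\<forall>e\<in>set mu. e > 0"
  shows "set_mset (tuple_mset mu is) = set is"
proof -
  have "set_mset (tuple_mset mu is) = (\<Union>k<length mu. {is ! k})"
    unfolding tuple_mset_def using assms by (subst set_mset_sum) auto
  also have "\<dots> = set is" using assms(1) by (auto simp: in_set_conv_nth)
  finally show ?thesis .
qed

lemma size_tuple_mset: "size (tuple_mset mu is) = sum_list mu"
  by (simp add: tuple_mset_def size_multiset_sum sum_list_sum_nth atLeast0LessThan)

lemma tuple_mset_count:
  assumes "distinct is" "set is = set_mset m"
  shows "tuple_mset (map (count m) is) is = m"
proof -
  have "tuple_mset (map (count m) is) is = (\<Sum>i\<in>set is. replicate_mset (count m i) i)"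
    using sum.reindex_bij_betw[OF bij_betw_nth[OF assms(1) refl refl],
        of "\<lambda>i. replicate_mset (count m i) i"]
    by (simp add: tuple_mset_def)
  also have "\<dots> = m"
    unfolding assms(2) by (rule multiset_eqI) (auto simp: count_sum count_eq_zero_iff)
  finally show ?thesis .
qed

text \<open>The complements of \<open>{..<length is}\<close> and \<open>set is\<close> are infinite
  sets of naturals, hence in bijection, and this bijection is glued to
  \<open>k \<mapsto> is ! k\<close>. The extension is needed because the coefficients are invariant
  under bijections of all indices.\<close>

lemma ex_bij_extending:
  fixes "is" :: "nat list"
  assumes "distinct is"
  shows "\<exists>\<pi>. bij \<pi> \<and> (\<forall>k<length is. \<pi> k = is ! k)"
proof -
  have "infinite (- {..<length is})" "infinite (- set is)" by (simp_all add: Compl_eq_Diff_UNIV Diff_infinite_finite)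
  then have "bij_betw (enumerate (- {..<length is})) UNIV (- {..<length is})"
    "bij_betw (enumerate (- set is)) UNIV (- set is)"
    by (simp_all add: bij_enumerate)
  then obtain g where g: "bij_betw g (- {..<length is}) (- set is)"
    by (meson bij_betw_inv_into bij_betw_trans)
  define \<pi> where "\<pi> k = (if k < length is then is ! k else g k)" for k
  have "bij_betw \<pi> {..<length is} (set is)"
    using bij_betw_nth[OF assms refl refl] by (subst bij_betw_cong[where g = "(!) is"]) (auto simp: \<pi>_def)
  moreover have "bij_betw \<pi> (- {..<length is}) (- set is)"
    using g by (subst bij_betw_cong[where g = g]) (auto simp: \<pi>_def)
  ultimately have "bij_betw \<pi> ({..<length is} \<union> - {..<length is}) (set is \<union> - set is)"
    by (rule bij_betw_combine) auto
  then have "bij \<pi>" by (simp only: Compl_partition)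
  then show ?thesis by (intro exI[of _ \<pi>]) (auto simp: \<pi>_def)
qed

text \<open>A permutation of the variables with \<open>k \<mapsto> is ! k\<close> carries the
  monomial on the first indices to the one on \<open>is\<close>, so the coefficient depends on the
  exponents only.\<close>

lemma sf_coeff_tuple_mset:
  assumes "distinct is" "length is = length mu"
  shows "sf_coeff F (tuple_mset mu is) = sf_coeff F (tuple_mset mu [0..<length mu])"
proof -
  obtain \<pi> where \<pi>: "bij \<pi>" "\<And>k. k < length is \<Longrightarrow> \<pi> k = is ! k"
    using ex_bij_extending[OF assms(1)] by blast
  have "image_mset \<pi> (tuple_mset mu [0..<length mu]) =
    (\<Sum>k<length mu. image_mset \<pi> (replicate_mset (mu ! k) ([0..<length mu] ! k)))"
    unfolding tuple_mset_def by (subst sum_comp_morphism[symmetric]) (auto simp: comp_def)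
  also have "\<dots> = tuple_mset mu is"
    unfolding tuple_mset_def by (intro sum.cong) (auto simp: \<pi>(2) assms(2))
  finally have "image_mset \<pi> (tuple_mset mu [0..<length mu]) = tuple_mset mu is" .
  moreover have "sf_coeff F (image_mset \<pi> m) = sf_coeff F m" for m
    using sf_coeff[of F] \<pi>(1) by blast
  ultimately show ?thesis by metis
qed

text \<open>\<open>M\<close> consists of compositions rather than partitions, and dividing by
  \<open>fact (length mu)\<close> in \<open>c\<close> compensates for the orderings of the support.
  \<open>M\<close> and \<open>c\<close> do not depend on \<open>xs\<close>, so one identity serves
  any number of variables.\<close>

lemma sf_eval_eq_sum_aug_monomial:
  obtains M :: "nat list set" and c :: "nat list \<Rightarrow> rat" where
    "finite M" "\<And>mu. mu \<in> M \<Longrightarrow> \<forall>e\<in>set mu. e > 0"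
    "\<And>xs. sf_eval F xs = (\<Sum>mu\<in>M. c mu * aug_monomial mu xs)"
proof -
  obtain d where d: "\<And>m. sf_coeff F m \<noteq> 0 \<Longrightarrow> size m \<le> d" using sf_degree_bounded by blast
  define M where "M = {mu. sum_list mu \<le> d \<and> (\<forall>e\<in>set mu. e > (0 :: nat))}"
  define c where "c mu = sf_coeff F (tuple_mset mu [0..<length mu]) / fact (length mu)" for mu
  have fin: "finite M"
  proof (rule finite_subset)
    show "M \<subseteq> {mu. set mu \<subseteq> {..d} \<and> length mu \<le> d}"
    proof
      fix mu assume mu: "mu \<in> M"
      have "length mu \<le> sum_list mu" if "\<forall>e\<in>set mu. e > (0 :: nat)" for mu
        using that by (induction mu) auto
      then have "length mu \<le> d" using mu by (fastforce simp: M_def)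
      moreover have "set mu \<subseteq> {..d}"
        using mu member_le_sum_list[of _ mu] by (fastforce simp: M_def)
      ultimately show "mu \<in> {mu. set mu \<subseteq> {..d} \<and> length mu \<le> d}" by simp
    qed
  qed (simp add: finite_lists_length_le)
  have "sf_eval F xs = (\<Sum>mu\<in>M. c mu * aug_monomial mu xs)" for xs
  proof -
    let ?n = "length xs"
    let ?z = "\<lambda>m. \<Prod>i\<in>#m. zero_extend xs i"
    have "sf_eval F xs = (\<Sum>m\<in>monomials ?n d. sf_coeff F m * ?z m)"
      by (rule sf_eval_eq_sum[OF d])
    \<comment> \<open>Averaging over all orderings of the support of a monomial avoids counting automorphisms.\<close>
    also have "\<dots> = (\<Sum>m\<in>monomials ?n d. \<Sum>is\<in>permutations_of_set (set_mset m).
        sf_coeff F m * ?z m / fact (length is))"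
    proof (rule sum.cong)
      fix m
      have "(\<Sum>is\<in>permutations_of_set (set_mset m). sf_coeff F m * ?z m / fact (length is)) =
        (\<Sum>is\<in>permutations_of_set (set_mset m). sf_coeff F m * ?z m / fact (card (set_mset m)))"
        by (intro sum.cong) (auto simp: permutations_of_set_def simp flip: distinct_card)
      then show "sf_coeff F m * ?z m =
        (\<Sum>is\<in>permutations_of_set (set_mset m). sf_coeff F m * ?z m / fact (length is))"
        by simp
    qed simp
    also have "\<dots> = (\<Sum>(m, is)\<in>(SIGMA m:monomials ?n d. permutations_of_set (set_mset m)).
        sf_coeff F m * ?z m / fact (length is))"
      by (simp add: sum.Sigma finite_monomials)
    \<comment> \<open>A monomial with an ordering of its support amounts to an exponent list with a
      tuple of distinct indices: \<open>count\<close> reads the exponents off, and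
      \<open>tuple_mset\<close> rebuilds the monomial.\<close>
    also have "\<dots> = (\<Sum>(mu, is)\<in>(SIGMA mu:M. distinct_tuples (length mu) ?n).
        c mu * (\<Prod>k<length mu. xs ! (is ! k) ^ (mu ! k)))"
    proof (rule sum.reindex_bij_witness[where
          i = "\<lambda>(mu, is). (tuple_mset mu is, is)" and j = "\<lambda>(m, is). (map (count m) is, is)"])
      fix p assume "p \<in> (SIGMA m:monomials ?n d. permutations_of_set (set_mset m))"
      then obtain m "is" where p: "p = (m, is)" and m: "set_mset m \<subseteq> {..<?n}" "size m \<le> d"
        and "is": "distinct is" "set is = set_mset m"
        by (auto simp: monomials_def permutations_of_set_def)
      note tm = tuple_mset_count[OF "is"]
      then show "(case case p of (m, is) \<Rightarrow> (map (count m) is, is) of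
          (mu, is) \<Rightarrow> (tuple_mset mu is, is)) = p"
        by (simp add: p)
      have "sum_list (map (count m) is) \<le> d"
        using m(2) size_tuple_mset[of "map (count m) is" "is"] by (simp add: tm)
      then show "(case p of (m, is) \<Rightarrow> (map (count m) is, is)) \<in>
          (SIGMA mu:M. distinct_tuples (length mu) ?n)"
        using m "is" by (auto simp: p M_def distinct_tuples_def)
      have "?z m = (\<Prod>i\<in>set is. zero_extend xs i ^ count m i)"
        by (simp add: image_prod_mset_multiplicity "is")
      also have "\<dots> = (\<Prod>k<length is. zero_extend xs (is ! k) ^ count m (is ! k))"
        using prod.reindex_bij_betw[OF bij_betw_nth[OF "is"(1) refl refl],
            of "\<lambda>i. zero_extend xs i ^ count m i"] by simp
      also have "\<dots> = (\<Prod>k<length is. xs ! (is ! k) ^ (map (count m) is ! k))"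
        using m(1) by (intro prod.cong) (auto simp: zero_extend_def "is"(2)[symmetric] subset_iff)
      finally show "(case case p of (m, is) \<Rightarrow> (map (count m) is, is) of
          (mu, is) \<Rightarrow> c mu * (\<Prod>k<length mu. xs ! (is ! k) ^ (mu ! k))) =
          (case p of (m, is) \<Rightarrow> sf_coeff F m * ?z m / fact (length is))"
        using sf_coeff_tuple_mset[OF "is"(1), of "map (count m) is" F] by (simp add: p c_def tm)
    next
      fix q assume "q \<in> (SIGMA mu:M. distinct_tuples (length mu) ?n)"
      then obtain mu "is" where q: "q = (mu, is)" and mu: "mu \<in> M"
        and "is": "length is = length mu" "distinct is" "set is \<subseteq> {..<?n}"
        by (auto simp: distinct_tuples_def)
      have pos: "\<forall>e\<in>set mu. e > 0" and "sum_list mu \<le> d" using mu by (auto simp: M_def)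
      then show "(case q of (mu, is) \<Rightarrow> (tuple_mset mu is, is)) \<in>
          (SIGMA m:monomials ?n d. permutations_of_set (set_mset m))"
        using "is" by (simp add: q monomials_def permutations_of_set_def set_tuple_mset size_tuple_mset)
      show "(case case q of (mu, is) \<Rightarrow> (tuple_mset mu is, is) of
          (m, is) \<Rightarrow> (map (count m) is, is)) = q"
        using "is" by (auto simp: q count_tuple_mset intro!: nth_equalityI)
    qed
    also have "\<dots> = (\<Sum>mu\<in>M. c mu * aug_monomial mu xs)"
      by (simp add: sum.Sigma[symmetric] fin finite_distinct_tuples aug_monomial_def sum_distrib_left)
    finally show ?thesis .
  qed
  with fin that[of M c] show thesis by (auto simp: M_def)
qed

text \<open>Generation by power sums, phrased as a closure principle for functions: \<open>A\<close>
  may be any algebra of functions, and the evaluation points \<open>v b\<close> may depend on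
  arbitrary data \<open>b\<close>. It suffices to treat augmented monomials, by induction on their
  number of parts.\<close>

lemma sf_eval_in_function_algebra:
  fixes A :: "('b \<Rightarrow> rat) set" and v :: "'b \<Rightarrow> rat list"
  assumes const: "\<And>c. (\<lambda>_. c) \<in> A"
    and add: "\<And>f g. f \<in> A \<Longrightarrow> g \<in> A \<Longrightarrow> (\<lambda>b. f b + g b) \<in> A"
    and mult: "\<And>f g. f \<in> A \<Longrightarrow> g \<in> A \<Longrightarrow> (\<lambda>b. f b * g b) \<in> A"
    and power_sums: "\<And>r. r > 0 \<Longrightarrow> (\<lambda>b. \<Sum>x\<leftarrow>v b. x ^ r) \<in> A"
  shows "(\<lambda>b. sf_eval F (v b)) \<in> A"
proof -
  have sum: "(\<lambda>b. \<Sum>i\<in>I. f i b) \<in> A" if "finite I" "\<And>i. i \<in> I \<Longrightarrow> f i \<in> A"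
    for I :: "'c set" and f :: "'c \<Rightarrow> 'b \<Rightarrow> rat"
    using that by (induction I rule: finite_induct) (auto intro: const add)
  have aug: "(\<lambda>b. aug_monomial mu (v b)) \<in> A" if "length mu = l" "\<forall>e\<in>set mu. e > 0" for l mu
    using that
  proof (induction l arbitrary: mu)
    case 0
    then have "aug_monomial mu (v b) = 1" for b
    proof -
      have "distinct_tuples 0 n = {[]}" for n by (auto simp: distinct_tuples_def)
      then show ?thesis using 0 by (simp add: aug_monomial_def)
    qed
    then show ?case by (simp add: const)
  next
    case (Suc l)
    then obtain r nu where mu: "mu = r # nu" and nu: "length nu = l" "\<forall>e\<in>set nu. e > 0" and r: "r > 0"
      by (cases mu) auto
    \<comment> \<open>The product rule is solved for its longest term; all other terms have
      \<open>l\<close> parts, with changed exponents, so the induction hypothesis must hold for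
      every list of that length. The difference is written with \<open>- 1\<close> because closure
      is given for sums, products and constants.\<close>
    have "aug_monomial mu (v b) = (\<Sum>x\<leftarrow>v b. x ^ r) * aug_monomial nu (v b) +
      (- 1) * (\<Sum>j<length nu. aug_monomial (nu[j := nu ! j + r]) (v b))" for b
      unfolding mu power_sum_times_aug_monomial by simp
    moreover have "(\<lambda>b. (\<Sum>x\<leftarrow>v b. x ^ r) * aug_monomial nu (v b) +
      (- 1) * (\<Sum>j<length nu. aug_monomial (nu[j := nu ! j + r]) (v b))) \<in> A"
    proof (intro add mult const sum power_sums r)
      show "(\<lambda>b. aug_monomial nu (v b)) \<in> A" by (rule Suc.IH[OF nu])
      show "(\<lambda>b. aug_monomial (nu[j := nu ! j + r]) (v b)) \<in> A" if "j \<in> {..<length nu}" for j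
      proof (rule Suc.IH)
        show "\<forall>e\<in>set (nu[j := nu ! j + r]). e > 0"
          using r nu(2) set_update_subset_insert[of nu j "nu ! j + r"] by auto
      qed (simp add: nu)
    qed simp
    ultimately show ?case by simp
  qed
  obtain M c where M: "finite M" "\<And>mu. mu \<in> M \<Longrightarrow> \<forall>e\<in>set mu. e > 0"
    "\<And>xs. sf_eval F xs = (\<Sum>mu\<in>M. c mu * aug_monomial mu xs)"
    using sf_eval_eq_sum_aug_monomial[of F] by metis
  show ?thesis
    unfolding M(3) by (intro sum mult const M(1) aug[OF refl] M(2))
qed

section \<open>Power sums of the modified contents\<close>

text \<open>Sums over a shifted diagram split into rows, so the power sums of the modified contents
  reduce to functions \<open>f\<close> of one row length. The admissible \<open>f\<close> form a
  linear space containing the odd powers.\<close>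

definition odd_trace :: "(nat \<Rightarrow> rat) \<Rightarrow> bool" where
  "odd_trace f \<longleftrightarrow>
    (\<exists>G\<in>supersymmetric. \<forall>lam. sf_eval G (map of_nat lam) = (\<Sum>x\<leftarrow>lam. f x))"

lemma odd_trace_add:
  assumes "odd_trace f" "odd_trace g"
  shows "odd_trace (\<lambda>x. f x + g x)"
proof -
  from assms obtain F G where "F \<in> supersymmetric" "G \<in> supersymmetric"
    "\<And>lam. sf_eval F (map of_nat lam) = (\<Sum>x\<leftarrow>lam. f x)"
    "\<And>lam. sf_eval G (map of_nat lam) = (\<Sum>x\<leftarrow>lam. g x)"
    unfolding odd_trace_def by blast
  then show ?thesis
    unfolding odd_trace_def using subalgebra_supersymmetric
    by (intro bexI[of _ "F + G"]) (auto simp: subalgebra_def sf_eval_add sum_list_addf)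
qed

lemma odd_trace_scale:
  assumes "odd_trace f"
  shows "odd_trace (\<lambda>x. c * f x)"
proof -
  from assms obtain F where "F \<in> supersymmetric"
    "\<And>lam. sf_eval F (map of_nat lam) = (\<Sum>x\<leftarrow>lam. f x)"
    unfolding odd_trace_def by blast
  then show ?thesis
    unfolding odd_trace_def using subalgebra_supersymmetric
    by (intro bexI[of _ "sf_scale c F"]) (auto simp: subalgebra_def sf_eval_scale sum_list_const_mult)
qed

lemma odd_trace_power:
  assumes "odd r"
  shows "odd_trace (\<lambda>x. of_nat x ^ r)"
  unfolding odd_trace_def
proof (intro bexI allI)
  show "power_sum r \<in> supersymmetric"
    unfolding supersymmetric_def using assms by (intro hull_inc) auto
  show "sf_eval (power_sum r) (map of_nat lam) = (\<Sum>x\<leftarrow>lam. of_nat x ^ r)" for lam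
    using odd_pos[OF assms] by (simp add: sf_eval_power_sum comp_def)
qed

text \<open>Expanding the last factor \<open>x ^ 2 - (k + 1) ^ 2\<close> either raises
  \<open>r\<close> by 2 or multiplies by a constant. Both keep the exponent odd, which is why
  \<open>r\<close> varies in the induction on \<open>k\<close>.\<close>

lemma odd_trace_central_factorial:
  assumes "odd r"
  shows "odd_trace (\<lambda>x. of_nat x ^ r * (\<Prod>j=1..k. of_nat x ^ 2 - of_nat j ^ 2))"
  using assms
proof (induction k arbitrary: r)
  case 0
  then show ?case by (simp add: odd_trace_power)
next
  case (Suc k)
  let ?P = "\<lambda>k x. \<Prod>j=1..k. of_nat x ^ 2 - of_nat j ^ 2 :: rat"
  have "odd_trace (\<lambda>x. of_nat x ^ (r + 2) * ?P k x)"
    by (rule Suc.IH) (use Suc.prems in simp)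
  moreover have "odd_trace (\<lambda>x. - (of_nat (Suc k) ^ 2) * (of_nat x ^ r * ?P k x))"
    by (intro odd_trace_scale Suc)
  ultimately have "odd_trace (\<lambda>x. of_nat x ^ (r + 2) * ?P k x +
      - (of_nat (Suc k) ^ 2) * (of_nat x ^ r * ?P k x))"
    by (rule odd_trace_add)
  moreover have "of_nat x ^ (r + 2) * ?P k x + - (of_nat (Suc k) ^ 2) * (of_nat x ^ r * ?P k x) =
      of_nat x ^ r * ?P (Suc k) x" for x :: nat
  proof -
    have "?P (Suc k) x = ?P k x * (of_nat x ^ 2 - of_nat (Suc k) ^ 2)" by simp
    then show ?thesis by (simp only: power_add left_diff_distrib right_diff_distrib) (simp add: mult_ac)
  qed
  ultimately show ?case by simp
qed

text \<open>
  The central factorial \<open>(y + k) \<cdots> (y - k)\<close> has forward difference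
  \<open>(2 k + 1) (y + k) \<cdots> (y + 1 - k)\<close>; pairing factors turns the first product into an odd
  polynomial in \<open>y\<close> and the second into a polynomial in \<open>y (y + 1)\<close>.
\<close>

lemma central_factorial_factor_left:
  fixes y :: rat
  shows "y * (\<Prod>j=1..k. y ^ 2 - of_nat j ^ 2) =
    (y - of_nat k) * (\<Prod>j=1..k. y * (y + 1) - of_nat j * (of_nat j - 1))"
proof (induction k)
  case (Suc k)
  define a where "a = (of_nat k :: rat)"
  define P where "P = (\<Prod>j=1..k. y * (y + 1) - of_nat j * (of_nat j - 1))"
  define Q where "Q = (\<Prod>j=1..k. y ^ 2 - of_nat j ^ 2)"
  have "y * Q = (y - a) * P" using Suc by (simp only: a_def P_def Q_def)
  \<comment> \<open>The new factors match because
    \<open>y (y + 1) - (a + 1) a = (y - a) (y + a + 1)\<close>.\<close>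
  then have "y * (Q * (y ^ 2 - (a + 1) ^ 2)) = (y - (a + 1)) * (P * (y * (y + 1) - (a + 1) * a))"
    by algebra
  then show ?case by (simp add: a_def P_def Q_def add.commute)
qed simp

text \<open>In \<open>(y + 1 + k) \<cdots> (y + 1 - k)\<close> the top factor stays alone, and the
  others pair up as \<open>(y + j) (y + 1 - j) = y (y + 1) - j (j - 1)\<close>.\<close>

lemma central_factorial_factor_right:
  fixes y :: rat
  shows "(y + 1) * (\<Prod>j=1..k. (y + 1) ^ 2 - of_nat j ^ 2) =
    (y + 1 + of_nat k) * (\<Prod>j=1..k. y * (y + 1) - of_nat j * (of_nat j - 1))"
proof (induction k)
  case (Suc k)
  define a where "a = (of_nat k :: rat)"
  define P where "P = (\<Prod>j=1..k. y * (y + 1) - of_nat j * (of_nat j - 1))"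
  define Q where "Q = (\<Prod>j=1..k. (y + 1) ^ 2 - of_nat j ^ 2)"
  have "(y + 1) * Q = (y + 1 + a) * P" using Suc by (simp only: a_def P_def Q_def)
  then have "(y + 1) * (Q * ((y + 1) ^ 2 - (a + 1) ^ 2)) =
      (y + 1 + (a + 1)) * (P * (y * (y + 1) - (a + 1) * a))"
    by algebra
  then show ?case by (simp add: a_def P_def Q_def add.commute)
qed simp

text \<open>The two factorizations at \<open>y = n\<close> share the product and differ by the
  factor \<open>(n + 1 + k) - (n - k) = 2 k + 1\<close>. The sum therefore telescopes, starting from
  0 at \<open>n = 0\<close>.\<close>

lemma sum_central_factorial:
  "(2 * of_nat k + 1) *
    (\<Sum>c<n. \<Prod>j=1..k. of_nat c * (of_nat c + 1) - of_nat j * (of_nat j - 1)) =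
    (of_nat n * (\<Prod>j=1..k. of_nat n ^ 2 - of_nat j ^ 2) :: rat)"
proof (induction n)
  case (Suc n)
  let ?P = "\<lambda>c. \<Prod>j=1..k. of_nat c * (of_nat c + 1) - of_nat j * (of_nat j - 1) :: rat"
  have "(2 * of_nat k + 1) * (\<Sum>c<Suc n. ?P c) =
      (2 * of_nat k + 1) * (\<Sum>c<n. ?P c) + (2 * of_nat k + 1) * ?P n"
    by (simp only: sum.lessThan_Suc distrib_left)
  also have "\<dots> = (of_nat n - of_nat k) * ?P n + (2 * of_nat k + 1) * ?P n"
    unfolding Suc central_factorial_factor_left ..
  also have "\<dots> = (of_nat n + 1 + of_nat k) * ?P n" by algebra
  also have "\<dots> = of_nat (Suc n) * (\<Prod>j=1..k. of_nat (Suc n) ^ 2 - of_nat j ^ 2)"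
    unfolding central_factorial_factor_right[symmetric] by (simp add: add.commute)
  finally show ?case .
qed simp

text \<open>Newton expansion in \<open>u = c (c + 1)\<close>: writing one factor \<open>u\<close> as
  \<open>(u - (k + 1) k) + (k + 1) k\<close> lowers the power of \<open>u\<close> and leaves
  products of index \<open>k + 1\<close> and \<open>k\<close>. Hence the induction on
  \<open>r\<close> runs over all \<open>k\<close>, down to \<open>sum_central_factorial\<close> at
  \<open>r = 0\<close>.\<close>

lemma odd_trace_sum_power:
  "odd_trace (\<lambda>n. \<Sum>c<n. (\<Prod>j=1..k. of_nat c * (of_nat c + 1) - of_nat j * (of_nat j - 1)) *
    (of_nat c * (of_nat c + 1)) ^ r)"
proof (induction r arbitrary: k)
  case 0
  have "odd_trace (\<lambda>n. 1 / (2 * of_nat k + 1) * (of_nat n ^ 1 * (\<Prod>j=1..k. of_nat n ^ 2 - of_nat j ^ 2)))"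
    by (intro odd_trace_scale odd_trace_central_factorial) simp
  moreover have "(\<Sum>c<n. \<Prod>j=1..k. of_nat c * (of_nat c + 1) - of_nat j * (of_nat j - 1)) =
    1 / (2 * of_nat k + 1) * (of_nat n ^ 1 * (\<Prod>j=1..k. of_nat n ^ 2 - of_nat j ^ 2) :: rat)" for n
  proof -
    have "2 * of_nat k + 1 \<noteq> (0 :: rat)" by (metis of_nat_Suc of_nat_mult of_nat_numeral of_nat_neq_0 add.commute)
    then show ?thesis using sum_central_factorial[of k n] by (simp add: field_simps)
  qed
  ultimately show ?case by simp
next
  case (Suc r)
  let ?u = "\<lambda>c. of_nat c * (of_nat c + 1) :: rat"
  let ?P = "\<lambda>k c. \<Prod>j=1..k. ?u c - of_nat j * (of_nat j - 1)"
  have "odd_trace (\<lambda>n. (\<Sum>c<n. ?P (Suc k) c * ?u c ^ r) +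
      of_nat (Suc k) * of_nat k * (\<Sum>c<n. ?P k c * ?u c ^ r))"
    by (intro odd_trace_add odd_trace_scale Suc)
  moreover have "?P k c * ?u c ^ Suc r =
      ?P (Suc k) c * ?u c ^ r + of_nat (Suc k) * of_nat k * (?P k c * ?u c ^ r)" for c
  proof -
    have "?P (Suc k) c = ?P k c * (?u c - of_nat (Suc k) * of_nat k)" by simp
    then show ?thesis by (simp only: power_Suc left_diff_distrib right_diff_distrib) (simp add: mult_ac)
  qed
  ultimately show ?case by (simp only: sum.distrib sum_distrib_left)
qed

section \<open>From rows to shifted diagrams\<close>

lemma sum_chat_power:
  assumes "distinct boxes" "set boxes = shifted_diagram lam"
  shows "(\<Sum>x\<leftarrow>map chat boxes. x ^ r) =
    (\<Sum>n\<leftarrow>lam. (1 / 2) ^ r * (\<Sum>c<n. (of_nat c * (of_nat c + 1)) ^ r))"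
proof -
  have "(\<Sum>x\<leftarrow>map chat boxes. x ^ r) = (\<Sum>b\<in>shifted_diagram lam. chat b ^ r)"
    using assms by (simp add: comp_def sum_list_distinct_conv_sum_set)
  also have "\<dots> = (\<Sum>(i, c)\<in>(SIGMA i:{..<length lam}. {..<lam ! i}).
      (1 / 2) ^ r * (of_nat c * (of_nat c + 1)) ^ r)"
    \<comment> \<open>List position \<open>i\<close> is row \<open>i + 1\<close>; its boxes lie in
      the columns \<open>i + 1 + c\<close> and have content \<open>c < lam ! i\<close>.\<close>
    by (rule sum.reindex_bij_witness[where
          i = "\<lambda>(i, c). (int i + 1, int i + 1 + int c)" and
          j = "\<lambda>(i, j). (nat (i - 1), nat (j - i))"])
      (auto simp: shifted_diagram_def chat_def Defs.content_def nat_add_distrib power_mult_distrib power_divide)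
  also have "\<dots> = (\<Sum>i<length lam. (1 / 2) ^ r * (\<Sum>c<lam ! i. (of_nat c * (of_nat c + 1)) ^ r))"
    by (simp add: sum.Sigma[symmetric] sum_distrib_left)
  also have "\<dots> = (\<Sum>n\<leftarrow>lam. (1 / 2) ^ r * (\<Sum>c<n. (of_nat c * (of_nat c + 1)) ^ r))"
    by (simp add: sum_list_sum_nth atLeast0LessThan)
  finally show ?thesis .
qed

text \<open>The closure principle is applied to the functions of box lists that some single
  \<open>G\<close> in \<open>supersymmetric\<close> realizes for all diagrams at once. They form an
  algebra because evaluation is multiplicative, and \<open>odd_trace\<close> supplies the power
  sums.\<close>

lemma ex_supersymmetric_chat:
  obtains G where "G \<in> supersymmetric"
    "\<And>lam boxes. distinct boxes \<Longrightarrow> set boxes = shifted_diagram lam \<Longrightarrow>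
      sf_eval G (map of_nat lam) = sf_eval F (map chat boxes)"
proof -
  define A where "A = {\<Phi>. \<exists>G\<in>supersymmetric. \<forall>lam boxes.
    distinct boxes \<and> set boxes = shifted_diagram lam \<longrightarrow> sf_eval G (map of_nat lam) = \<Phi> boxes}"
  have alg: "1 \<in> supersymmetric"
    "\<And>G H. G \<in> supersymmetric \<Longrightarrow> H \<in> supersymmetric \<Longrightarrow> G + H \<in> supersymmetric"
    "\<And>G H. G \<in> supersymmetric \<Longrightarrow> H \<in> supersymmetric \<Longrightarrow> G * H \<in> supersymmetric"
    "\<And>c G. G \<in> supersymmetric \<Longrightarrow> sf_scale c G \<in> supersymmetric"
    using subalgebra_supersymmetric by (auto simp: subalgebra_def)
  have "(\<lambda>boxes. sf_eval F (map chat boxes)) \<in> A"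
  proof (rule sf_eval_in_function_algebra)
    show "(\<lambda>_. c) \<in> A" for c
      unfolding A_def using alg by (auto intro!: bexI[of _ "sf_scale c 1"] simp: sf_eval_scale sf_eval_one)
  next
    fix \<Phi> \<Psi> assume "\<Phi> \<in> A" "\<Psi> \<in> A"
    then obtain G H where G: "G \<in> supersymmetric" "\<And>lam boxes. distinct boxes \<Longrightarrow>
        set boxes = shifted_diagram lam \<Longrightarrow> sf_eval G (map of_nat lam) = \<Phi> boxes"
      and H: "H \<in> supersymmetric" "\<And>lam boxes. distinct boxes \<Longrightarrow>
        set boxes = shifted_diagram lam \<Longrightarrow> sf_eval H (map of_nat lam) = \<Psi> boxes"
      unfolding A_def by blast
    show "(\<lambda>b. \<Phi> b + \<Psi> b) \<in> A"
      unfolding A_def using G H alg by (auto intro!: bexI[of _ "G + H"] simp: sf_eval_add)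
    show "(\<lambda>b. \<Phi> b * \<Psi> b) \<in> A"
      unfolding A_def using G H alg by (auto intro!: bexI[of _ "G * H"] simp: sf_eval_mult)
  next
    fix r :: nat
    \<comment> \<open>With \<open>k = 0\<close> the product in \<open>odd_trace_sum_power\<close> is
      empty, which leaves pure powers of \<open>c (c + 1)\<close>.\<close>
    have "odd_trace (\<lambda>n. (1 / 2) ^ r * (\<Sum>c<n. (of_nat c * (of_nat c + 1)) ^ r))"
      using odd_trace_sum_power[of 0 r] by (intro odd_trace_scale) simp
    then obtain G where "G \<in> supersymmetric" "\<And>lam. sf_eval G (map of_nat lam) =
        (\<Sum>n\<leftarrow>lam. (1 / 2) ^ r * (\<Sum>c<n. (of_nat c * (of_nat c + 1)) ^ r))"
      unfolding odd_trace_def by blast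
    then show "(\<lambda>boxes. \<Sum>x\<leftarrow>map chat boxes. x ^ r) \<in> A"
      unfolding A_def by (auto intro!: bexI[of _ G] simp only: sum_chat_power mem_Collect_eq)
  qed
  then show thesis using that unfolding A_def by blast
qed

theorem theorem1p4:
  fixes F :: symfun
  shows "\<exists>!G. G \<in> supersymmetric \<and>
    (\<forall>lam. strict_partition lam \<longrightarrow>
      (\<forall>boxes. distinct boxes \<and> set boxes = shifted_diagram lam \<longrightarrow>
        sf_eval G (map of_nat lam) = sf_eval F (map chat boxes)))"
proof (rule ex_ex1I)
  show "\<exists>G. G \<in> supersymmetric \<and> (\<forall>lam. strict_partition lam \<longrightarrow>
      (\<forall>boxes. distinct boxes \<and> set boxes = shifted_diagram lam \<longrightarrow>
        sf_eval G (map of_nat lam) = sf_eval F (map chat boxes)))"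
    using ex_supersymmetric_chat[of F] by metis
next
  fix G H
  assume G: "G \<in> supersymmetric \<and> (\<forall>lam. strict_partition lam \<longrightarrow>
      (\<forall>boxes. distinct boxes \<and> set boxes = shifted_diagram lam \<longrightarrow>
        sf_eval G (map of_nat lam) = sf_eval F (map chat boxes)))"
    and H: "H \<in> supersymmetric \<and> (\<forall>lam. strict_partition lam \<longrightarrow>
      (\<forall>boxes. distinct boxes \<and> set boxes = shifted_diagram lam \<longrightarrow>
        sf_eval H (map of_nat lam) = sf_eval F (map chat boxes)))"
  show "G = H"
  proof (rule symfun_eqI_strict)
    fix lam assume "strict_partition lam"
    \<comment> \<open>Finiteness of the diagram supplies an enumeration of its boxes; without one
      the assumptions on \<open>G\<close> and \<open>H\<close> would say nothing about
      \<open>lam\<close>.\<close>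
    moreover obtain boxes where "distinct boxes" "set boxes = shifted_diagram lam"
      using finite_distinct_list[OF finite_shifted_diagram] by metis
    ultimately show "sf_eval G (map of_nat lam) = sf_eval H (map of_nat lam)"
      using G H by metis
  qed
qed

end
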